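(* Let $X=\{X(t),t\ge 0\}$ be a continuous-time stochastic process with values in a Polish space $\mathcal{S}$ (with Borel $\sigma$-field $\mathcal{B}(\mathcal{S})$), right continuous with left-hand limits. Let $\mathcal{D},\mathcal{U}\in\mathcal{B}(\mathcal{S})$ be non-empty and disjoint, and suppose that almost surely $X$ gets into $\mathcal{U}$ and gets into $\mathcal{D}$ infinitely often in $[0,\infty)$, but at most finitely often in every finite time interval $[0,t)$, $t\ge 0$. Let $N^{\mathcal{U}}(t)$ and $N^{\mathcal{D}}(t)$ be the numbers of $\mathcal{U}$-segments and $\mathcal{D}$-segments completed by time $t$. Then the following limits, if they exist, are equal: $$\lim_{t\to \infty} \frac{N^{\mathcal{U}}(t)}{t} = \lim_{t\to \infty} \frac{N^{\mathcal{D}}(t)}{t}.$$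
   Context: The process $X$ is not assumed to be Markovian. For $\mathcal{V}\in\{\mathcal{U},\mathcal{D}\}$ put $I^{\mathcal{V}}_0:=0$ and $$I^{\mathcal{V}}_n=\inf\{t>I^{\mathcal{V}}_{n-1} : X(t^-)\notin \mathcal{V},\ X(t)\in \mathcal{V}\},\quad n\ge 1,$$ the successive time instants at which $X$ gets into $\mathcal{V}$. The counting processes of $\mathcal{U}$-segments and $\mathcal{D}$-segments are $$N^{\mathcal{U}}(t)=\#\{k\ge 1 : I^{\mathcal{U}}_k\le t,\ \exists m\ge 1 \text{ such that } I^{\mathcal{U}}_{k-1}<I^{\mathcal{D}}_{m}<I^{\mathcal{U}}_{k}\},$$ $$N^{\mathcal{D}}(t)=\#\{k\ge 1 : I^{\mathcal{D}}_k\le t,\ \exists m\ge 1 \text{ such that } I^{\mathcal{D}}_{k-1}<I^{\mathcal{U}}_{m}<I^{\mathcal{D}}_{k}\}.$$ (A $\mathcal{U}$-segment is a path segment that begins in $\mathcal{D}$, ends in $\mathcal{U}$ and otherwise stays in $\mathcal{M}=\mathcal{S}\setminus(\mathcal{D}\cup\mathcal{U})$; a $\mathcal{D}$-segment is defined symmetrically.) The equality is understood sample-pathwise, almost surely. *)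

theory Defs
  imports "HOL-Probability.Probability"
begin

(* Paths are functions on real; only their restriction to [0, oo) matters below. *)

definition cadlag :: "(real \<Rightarrow> 'a::topological_space) \<Rightarrow> bool" where
  "cadlag x \<longleftrightarrow>
     (\<forall>t\<ge>0. (x \<longlongrightarrow> x t) (at_right t)) \<and>
     (\<forall>t>0. \<exists>l. (x \<longlongrightarrow> l) (at_left t))"

definition left_lim :: "(real \<Rightarrow> 'a::t2_space) \<Rightarrow> real \<Rightarrow> 'a" where
  "left_lim x t = Lim (at_left t) x"

(* There is no left limit at time 0, so starting inside V is not an entry into V. *)
definition entry_instants :: "(real \<Rightarrow> 'a::t2_space) \<Rightarrow> 'a set \<Rightarrow> real set" where
  "entry_instants x V = {t. 0 < t \<and> left_lim x t \<notin> V \<and> x t \<in> V}"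

(* Extended reals give the convention that the infimum of the empty set is infinity. *)
primrec entry_time :: "(real \<Rightarrow> 'a::t2_space) \<Rightarrow> 'a set \<Rightarrow> nat \<Rightarrow> ereal" where
  "entry_time x V 0 = 0"
| "entry_time x V (Suc n) = Inf {ereal t | t. entry_time x V n < ereal t \<and> t \<in> entry_instants x V}"

(* Segments from A to B completed by time t. The index set is finite whenever the entries
   into B are locally finite, so the value 0 of card on infinite sets plays no role then. *)
definition segment_count :: "(real \<Rightarrow> 'a::t2_space) \<Rightarrow> 'a set \<Rightarrow> 'a set \<Rightarrow> real \<Rightarrow> nat" where
  "segment_count x A B t =
     card {k. 1 \<le> k \<and> entry_time x B k \<le> ereal t \<and>
              (\<exists>m\<ge>1. entry_time x B (k - 1) < entry_time x A m \<and> entry_time x A m < entry_time x B k)}"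

end

theory Submission
  imports Defs
begin

text \<open>
  The theorem is a pathwise statement. On a path with locally finite entries, list all entries into \<open>D\<close> and into \<open>U\<close>
  in temporal order; since the sets are disjoint, no instant is an entry into both. A
  \<open>U\<close>-segment ends at each entry into \<open>U\<close> whose predecessor in the merged list is an entry into
  \<open>D\<close>, and symmetrically for \<open>D\<close>-segments (\<open>segment_count_eq_card\<close>). So the two kinds of segment
  ends are the two kinds of letter changes in a word over a two-letter alphabet, and these
  alternate (\<open>segment_end_between\<close>). Alternating finite sets differ in size by at most one
  (\<open>card_le_Suc_interlacing\<close>), hence \<open>N\<^sup>U(t)\<close> and \<open>N\<^sup>D(t)\<close> differ by at most one at every time, and
  after division by \<open>t\<close> the difference vanishes.
\<close>

section \<open>Interlacing sets\<close>

text \<open>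
  Induction on the largest point of \<open>P\<close>: only the part of \<open>Q\<close> below the previous maximum serves
  the smaller points, so the element of \<open>Q\<close> beneath the new maximum is an additional one.
\<close>

lemma card_le_Suc_interlacing:
  fixes P Q :: "'b::linorder set"
  assumes "finite P" and "finite Q"
    and "\<And>p p'. p \<in> P \<Longrightarrow> p' \<in> P \<Longrightarrow> p < p' \<Longrightarrow> \<exists>q\<in>Q. p < q \<and> q < p'"
  shows "card P \<le> Suc (card Q)"
  using assms
proof (induction P arbitrary: Q rule: finite_linorder_max_induct)
  case empty
  show ?case by simp
next
  case (insert p P)
  show ?case
  proof (cases "P = {}")
    case True
    then show ?thesis by simp
  next
    case False
    define m where "m = Max P"
    have m: "m \<in> P" "\<And>x. x \<in> P \<Longrightarrow> x \<le> m"
      using insert.hyps(1) False by (auto simp: m_def)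
    define Q' where "Q' = {q \<in> Q. q < m}"
    have "card P \<le> Suc (card Q')"
    proof (rule insert.IH)
      show "finite Q'" using insert.prems(1) by (simp add: Q'_def)
      fix x y assume "x \<in> P" "y \<in> P" "x < y"
      then obtain q where "q \<in> Q" "x < q" "q < y" using insert.prems(2)[of x y] by auto
      then show "\<exists>q\<in>Q'. x < q \<and> q < y" using m(2)[OF \<open>y \<in> P\<close>] by (auto simp: Q'_def)
    qed
    moreover obtain q where "q \<in> Q" "m < q"
      using insert.prems(2)[of m p] insert.hyps(2) m(1) by auto
    then have "q \<in> Q - Q'" and "Q' \<subseteq> Q" by (auto simp: Q'_def)
    then have "Q' \<subset> Q" by blast
    then have "card Q' < card Q" using insert.prems(1) by (rule psubset_card_mono[rotated])
    ultimately show ?thesis using insert.hyps by (simp add: card_insert_if)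
  qed
qed

section \<open>Alternation of segment ends\<close>

text \<open>
  Segments from \<open>A\<close> to \<open>B\<close> described by instants instead of indices: the interval from the
  witness \<open>a\<close> to the end \<open>b\<close> contains no earlier point of \<open>B\<close>.
\<close>

definition segment_ends :: "real set \<Rightarrow> real set \<Rightarrow> real set" where
  "segment_ends A B = {b \<in> B. \<exists>a\<in>A. a < b \<and> B \<inter> {a..<b} = {}}"

text \<open>
  After the first of two segments from \<open>A\<close> to \<open>B\<close>, the process must return to \<open>A\<close> before it can
  complete the second one; the first such return ends a segment from \<open>B\<close> to \<open>A\<close>.
\<close>

lemma segment_end_between:
  assumes disj: "A \<inter> B = {}" and fin: "finite (A \<inter> {..b'})"
    and b: "b \<in> segment_ends A B" and b': "b' \<in> segment_ends A B" and less: "b < b'"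
  shows "\<exists>a \<in> segment_ends B A. b < a \<and> a < b'"
proof -
  from b have bB: "b \<in> B" by (simp add: segment_ends_def)
  from b' obtain a where a: "a \<in> A" "a < b'" "B \<inter> {a..<b'} = {}"
    by (auto simp: segment_ends_def)
  have "b < a" using a(3) bB less by (force simp: not_less)
  define R where "R = A \<inter> {b<..<b'}"
  have "finite R" by (rule finite_subset[OF _ fin]) (auto simp: R_def)
  moreover have "a \<in> R" using a \<open>b < a\<close> by (simp add: R_def)
  ultimately have min: "Min R \<in> R" "\<And>x. x \<in> R \<Longrightarrow> Min R \<le> x"
    by (metis Min_in empty_iff, metis Min_le)
  have "A \<inter> {b..<Min R} = {}"
  proof (rule ccontr)
    assume "A \<inter> {b..<Min R} \<noteq> {}"
    then obtain x where x: "x \<in> A" "b \<le> x" "x < Min R" by auto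
    then have "x \<in> R" using min(1) bB disj by (force simp: R_def)
    then show False using min(2)[of x] x by simp
  qed
  then have "Min R \<in> segment_ends B A"
    using min(1) bB by (auto simp: segment_ends_def R_def)
  then show ?thesis using min(1) by (auto simp: R_def)
qed

lemma card_segment_ends_le:
  assumes disj: "A \<inter> B = {}"
    and finA: "finite (A \<inter> {..t})" and finB: "finite (B \<inter> {..t})"
  shows "card (segment_ends A B \<inter> {..t}) \<le> Suc (card (segment_ends B A \<inter> {..t}))"
proof (rule card_le_Suc_interlacing)
  show "finite (segment_ends A B \<inter> {..t})"
    by (rule finite_subset[OF _ finB]) (auto simp: segment_ends_def)
  show "finite (segment_ends B A \<inter> {..t})"
    by (rule finite_subset[OF _ finA]) (auto simp: segment_ends_def)
next
  fix b b' assume b: "b \<in> segment_ends A B \<inter> {..t}" "b' \<in> segment_ends A B \<inter> {..t}" "b < b'"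
  have "finite (A \<inter> {..b'})" by (rule finite_subset[OF _ finA]) (use b in auto)
  from segment_end_between[OF disj this, of b] b
  show "\<exists>q\<in>segment_ends B A \<inter> {..t}. b < q \<and> q < b'" by fastforce
qed

section \<open>Entry times enumerate the entry instants\<close>

lemma finite_entry_instants_atMost:
  assumes "\<forall>t\<ge>0. finite (entry_instants x V \<inter> {0..<t})"
  shows "finite (entry_instants x V \<inter> {..t})"
proof (rule finite_subset)
  show "entry_instants x V \<inter> {..t} \<subseteq> entry_instants x V \<inter> {0..<\<bar>t\<bar> + 1}"
    by (auto simp: entry_instants_def)
qed (use assms in auto)

text \<open>Local finiteness makes the infimum defining the next entry time a minimum.\<close>

lemma entry_time_Suc_attained:
  assumes fin: "\<And>t. finite (entry_instants x V \<inter> {..t})"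
    and s: "s \<in> entry_instants x V" "entry_time x V n < ereal s"
  obtains t where "entry_time x V (Suc n) = ereal t" "t \<in> entry_instants x V"
    "entry_time x V n < ereal t" "t \<le> s"
proof -
  define R where "R = {t \<in> entry_instants x V. entry_time x V n < ereal t} \<inter> {..s}"
  have "finite R" by (rule finite_subset[OF _ fin[of s]]) (auto simp: R_def)
  moreover have "s \<in> R" using s by (simp add: R_def)
  ultimately have min: "Min R \<in> R" "\<And>r. r \<in> R \<Longrightarrow> Min R \<le> r"
    by (metis Min_in empty_iff, metis Min_le)
  have "Min R \<le> t" if "entry_time x V n < ereal t" "t \<in> entry_instants x V" for t
    using that min(1) min(2)[of t] by (cases "t \<le> s") (auto simp: R_def)
  then have "entry_time x V (Suc n) = ereal (Min R)"
    using min(1) by (auto simp: R_def intro!: Inf_eqI)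
  then show ?thesis using that min(1) by (auto simp: R_def)
qed

lemma entry_time_Suc_cases:
  assumes fin: "\<And>t. finite (entry_instants x V \<inter> {..t})"
  obtains (infinity) "entry_time x V (Suc n) = \<infinity>"
  | (finite) t where "entry_time x V (Suc n) = ereal t" "t \<in> entry_instants x V"
      "entry_time x V n < ereal t"
      "\<And>s. s \<in> entry_instants x V \<Longrightarrow> entry_time x V n < ereal s \<Longrightarrow> t \<le> s"
proof (cases "\<exists>s \<in> entry_instants x V. entry_time x V n < ereal s")
  case True
  then obtain s where "s \<in> entry_instants x V" "entry_time x V n < ereal s" by blast
  from entry_time_Suc_attained[OF fin this] obtain t where
    t: "entry_time x V (Suc n) = ereal t" "t \<in> entry_instants x V" "entry_time x V n < ereal t"
    by metis
  have "t \<le> s" if "s \<in> entry_instants x V" "entry_time x V n < ereal s" for s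
    using entry_time_Suc_attained[OF fin that] t(1) by (metis ereal.inject)
  with t show ?thesis by (rule finite)
next
  case False
  then have "{ereal t | t. entry_time x V n < ereal t \<and> t \<in> entry_instants x V} = {}" by blast
  then have "entry_time x V (Suc n) = \<infinity>"
    by (simp only: entry_time.simps Inf_empty top_ereal_def)
  then show ?thesis by (rule infinity)
qed

lemma entry_time_mono: "i \<le> j \<Longrightarrow> entry_time x V i \<le> entry_time x V j"
proof (rule lift_Suc_mono_le[of "entry_time x V"])
  fix n
  show "entry_time x V n \<le> entry_time x V (Suc n)"
    unfolding entry_time.simps by (rule Inf_greatest) (auto intro: less_imp_le)
qed

lemma entry_time_strict_mono:
  assumes fin: "\<And>t. finite (entry_instants x V \<inter> {..t})"
    and "i < j" and "entry_time x V j \<noteq> \<infinity>"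
  shows "entry_time x V i < entry_time x V j"
proof -
  have le: "entry_time x V (Suc i) \<le> entry_time x V j"
    using \<open>i < j\<close> by (intro entry_time_mono) simp
  show ?thesis
    using fin
  proof (cases rule: entry_time_Suc_cases[of x V i])
    case infinity
    then show ?thesis using le assms(3) by simp
  next
    case (finite t)
    then show ?thesis using le by simp
  qed
qed

lemma entry_time_in_entry_instants:
  assumes fin: "\<And>t. finite (entry_instants x V \<inter> {..t})"
    and "1 \<le> k" and "entry_time x V k = ereal t"
  shows "t \<in> entry_instants x V"
proof -
  from \<open>1 \<le> k\<close> obtain n where "k = Suc n" by (cases k) auto
  then show ?thesis using entry_time_Suc_cases[OF fin, of n] assms(3) by fastforce
qed

text \<open>
  Induction on the number of earlier entry instants: if the last of them is the \<open>n\<close>-th entry time,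
  then \<open>t\<close> is the next one.
\<close>

lemma entry_time_surj:
  assumes fin: "\<And>t. finite (entry_instants x V \<inter> {..t})"
    and "t \<in> entry_instants x V"
  shows "\<exists>k\<ge>1. entry_time x V k = ereal t"
  using assms(2)
proof (induction "card (entry_instants x V \<inter> {..<t})" arbitrary: t rule: less_induct)
  case less
  define R where "R = entry_instants x V \<inter> {..<t}"
  have finR: "finite R" by (rule finite_subset[OF _ fin[of t]]) (auto simp: R_def)
  \<comment> \<open>Index 0 is the convention for the start of the path, which serves as predecessor of the
    first entry.\<close>
  have "\<exists>n. entry_time x V n < ereal t \<and> (\<forall>s\<in>R. ereal s \<le> entry_time x V n)"
  proof (cases "R = {}")
    case True
    then show ?thesis using less.prems by (intro exI[of _ 0]) (simp add: entry_instants_def)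
  next
    case False
    then have max: "Max R \<in> R" "\<And>s. s \<in> R \<Longrightarrow> s \<le> Max R" using finR by auto
    then have "entry_instants x V \<inter> {..<Max R} \<subset> R" by (auto simp: R_def)
    then have "card (entry_instants x V \<inter> {..<Max R}) < card R" by (rule psubset_card_mono[OF finR])
    then obtain k where "entry_time x V k = ereal (Max R)"
      using less.hyps[of "Max R"] max(1) by (auto simp: R_def)
    then show ?thesis using max by (intro exI[of _ k]) (auto simp: R_def)
  qed
  then obtain n where n: "entry_time x V n < ereal t" "\<And>s. s \<in> R \<Longrightarrow> ereal s \<le> entry_time x V n"
    by blast
  obtain u where u: "entry_time x V (Suc n) = ereal u" "u \<in> entry_instants x V"
    "entry_time x V n < ereal u" "u \<le> t"
    using entry_time_Suc_attained[OF fin less.prems n(1)] by metis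
  have "u \<notin> R" using n(2)[of u] u(3) by auto
  then have "u = t" using u by (auto simp: R_def)
  then show ?case using u(1) by (intro exI[of _ "Suc n"]) auto
qed

section \<open>Segment counts as cardinalities of sets of instants\<close>

text \<open>
  The entry time maps indices bijectively to entry instants. There is no entry into \<open>B\<close> strictly
  between the entry times with indices \<open>k - 1\<close> and \<open>k\<close>, so an entry into \<open>A\<close> at an instant \<open>a\<close> lies
  between them exactly if \<open>a\<close> precedes the latter and no entry into \<open>B\<close> falls in the interval from
  \<open>a\<close> up to it.
\<close>

lemma segment_count_eq_card:
  assumes finA: "\<And>t. finite (entry_instants x A \<inter> {..t})"
    and finB: "\<And>t. finite (entry_instants x B \<inter> {..t})"
  shows "segment_count x A B t
       = card (segment_ends (entry_instants x A) (entry_instants x B) \<inter> {..t})"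
proof -
  let ?TA = "entry_instants x A" and ?TB = "entry_instants x B"
  let ?eA = "entry_time x A" and ?eB = "entry_time x B"
  define K where "K = {k. 1 \<le> k \<and> ?eB k \<le> ereal t \<and> (\<exists>m\<ge>1. ?eB (k - 1) < ?eA m \<and> ?eA m < ?eB k)}"
  have "bij_betw ?eB K (ereal ` (segment_ends ?TA ?TB \<inter> {..t}))"
  proof (rule bij_betw_imageI)
    show "inj_on ?eB K"
    proof (rule linorder_inj_onI)
      fix i j assume "i < j" "i \<in> K" "j \<in> K"
      then have "?eB j \<noteq> \<infinity>" by (auto simp: K_def)
      then show "?eB i \<noteq> ?eB j" using entry_time_strict_mono[OF finB \<open>i < j\<close>] by simp
    qed auto
    show "?eB ` K = ereal ` (segment_ends ?TA ?TB \<inter> {..t})"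
    proof (intro equalityI subsetI)
      fix y assume "y \<in> ?eB ` K"
      then obtain k m where k: "1 \<le> k" "y = ?eB k" "?eB k \<le> ereal t"
        and m: "1 \<le> m" "?eB (k - 1) < ?eA m" "?eA m < ?eB k"
        by (auto simp: K_def)
      have nonneg: "0 \<le> ?eB (k - 1)" using entry_time_mono[of 0 "k - 1" x B] by simp
      obtain a where a: "?eA m = ereal a"
        using m k(3) nonneg by (cases "?eA m") auto
      obtain n where n: "k = Suc n" using k(1) by (cases k) auto
      show "y \<in> ereal ` (segment_ends ?TA ?TB \<inter> {..t})"
        using finB
      proof (cases rule: entry_time_Suc_cases[of x B n])
        case infinity
        then show ?thesis using k n by simp
      next
        case (finite b)
        have "a \<in> ?TA" using entry_time_in_entry_instants[OF finA m(1) a] .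
        moreover have "a < b" using m(3) a finite(1) n by simp
        moreover have "?TB \<inter> {a..<b} = {}"
        proof (rule ccontr)
          assume "?TB \<inter> {a..<b} \<noteq> {}"
          then obtain s where s: "s \<in> ?TB" "a \<le> s" "s < b" by auto
          have "?eB n < ereal a" using m(2) a n by simp
          then have "?eB n < ereal s" using s(2) by (meson ereal_less_eq(3) less_le_trans)
          then show False using finite(4)[OF s(1)] s(3) by simp
        qed
        ultimately have "b \<in> segment_ends ?TA ?TB"
          using finite(2) by (auto simp: segment_ends_def)
        then show ?thesis using k finite(1) n by auto
      qed
    next
      fix y assume "y \<in> ereal ` (segment_ends ?TA ?TB \<inter> {..t})"
      then obtain b a where b: "y = ereal b" "b \<in> ?TB" "b \<le> t"
        and a: "a \<in> ?TA" "a < b" "?TB \<inter> {a..<b} = {}"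
        by (auto simp: segment_ends_def)
      obtain k where k: "1 \<le> k" "?eB k = ereal b" using entry_time_surj[OF finB b(2)] by auto
      obtain m where m: "1 \<le> m" "?eA m = ereal a" using entry_time_surj[OF finA a(1)] by auto
      have "?eB (k - 1) < ereal a"
      proof (cases "k = 1")
        case True
        then show ?thesis using a(1) by (simp add: entry_instants_def)
      next
        case False
        have less: "?eB (k - 1) < ereal b"
          using entry_time_strict_mono[OF finB, of "k - 1" k] k by simp
        moreover have "0 \<le> ?eB (k - 1)" using entry_time_mono[of 0 "k - 1" x B] by simp
        ultimately obtain c where c: "?eB (k - 1) = ereal c" by (cases "?eB (k - 1)") auto
        then have "c \<in> ?TB"
          using False k(1) by (intro entry_time_in_entry_instants[OF finB, of "k - 1"]) auto
        then show ?thesis using a(3) less c by (force simp: not_less)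
      qed
      then have "k \<in> K" using k m a(2) b(3) by (auto simp: K_def)
      then show "y \<in> ?eB ` K" using b(1) k(2) by (metis imageI)
    qed
  qed
  then have "card K = card (ereal ` (segment_ends ?TA ?TB \<inter> {..t}))"
    by (rule bij_betw_same_card)
  then show ?thesis by (simp add: segment_count_def K_def card_image)
qed

lemma disjoint_entry_instants:
  "A \<inter> B = {} \<Longrightarrow> entry_instants x A \<inter> entry_instants x B = {}"
  by (auto simp: entry_instants_def)

lemma segment_count_le:
  assumes "A \<inter> B = {}"
    and "\<And>t. finite (entry_instants x A \<inter> {..t})"
    and "\<And>t. finite (entry_instants x B \<inter> {..t})"
  shows "segment_count x A B t \<le> Suc (segment_count x B A t)"
  by (simp add: segment_count_eq_card assms card_segment_ends_le disjoint_entry_instants)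

section \<open>Equality of the long-run rates\<close>

lemma rate_limit_le:
  fixes f g :: "real \<Rightarrow> nat" and a b :: ereal
  assumes le: "\<And>t. f t \<le> Suc (g t)"
    and f: "((\<lambda>t. ereal (real (f t) / t)) \<longlongrightarrow> a) at_top"
    and g: "((\<lambda>t. ereal (real (g t) / t)) \<longlongrightarrow> b) at_top"
  shows "a \<le> b"
proof -
  have "((\<lambda>t::real. 1 / t) \<longlongrightarrow> 0) at_top"
    by (intro tendsto_divide_0[OF tendsto_const] filterlim_at_top_imp_at_infinity filterlim_ident)
  then have "((\<lambda>t::real. ereal (1 / t)) \<longlongrightarrow> ereal 0) at_top"
    by (rule tendsto_ereal)
  \<comment> \<open>The rate limit may be infinite; the sum is still continuous there because the other limit is
    finite.\<close>
  from tendsto_add_ereal_general[OF _ g this]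
  have "((\<lambda>t. ereal (real (g t) / t) + ereal (1 / t)) \<longlongrightarrow> b) at_top"
    by (simp add: zero_ereal_def[symmetric])
  moreover have "eventually (\<lambda>t. ereal (real (f t) / t) \<le> ereal (real (g t) / t) + ereal (1 / t)) at_top"
    using eventually_gt_at_top[of 0]
  proof eventually_elim
    case (elim t)
    have "real (f t) \<le> real (g t) + 1" using le[of t] by linarith
    then have "real (f t) / t \<le> (real (g t) + 1) / t" using elim by (intro divide_right_mono) auto
    then show ?case by (simp add: add_divide_distrib)
  qed
  ultimately show ?thesis using f by (intro tendsto_le[of at_top]) auto
qed

theorem theorem1:
  fixes M :: "'w measure"
    and X :: "real \<Rightarrow> 'w \<Rightarrow> 'a::polish_space"
    and D U :: "'a set"
  assumes "prob_space M"
    and "\<And>t. 0 \<le> t \<Longrightarrow> X t \<in> measurable M borel"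
    and "\<And>\<omega>. \<omega> \<in> space M \<Longrightarrow> cadlag (\<lambda>t. X t \<omega>)"
    and "D \<in> sets borel" and "U \<in> sets borel"
    and "D \<noteq> {}" and "U \<noteq> {}" and "D \<inter> U = {}"
    and "AE \<omega> in M. \<forall>V\<in>{U, D}.
           infinite (entry_instants (\<lambda>t. X t \<omega>) V) \<and>
           (\<forall>t\<ge>0. finite (entry_instants (\<lambda>t. X t \<omega>) V \<inter> {0..<t}))"
  shows "AE \<omega> in M. \<forall>lU lD :: ereal.
           ((\<lambda>t. ereal (real (segment_count (\<lambda>s. X s \<omega>) D U t) / t)) \<longlongrightarrow> lU) at_top \<longrightarrow>
           ((\<lambda>t. ereal (real (segment_count (\<lambda>s. X s \<omega>) U D t) / t)) \<longlongrightarrow> lD) at_top \<longrightarrow>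
           lU = lD"
  using assms(9)
proof eventually_elim
  case (elim \<omega>)
  let ?x = "\<lambda>t. X t \<omega>"
  have finD: "finite (entry_instants ?x D \<inter> {..t})" for t
    using elim by (intro finite_entry_instants_atMost) blast
  have finU: "finite (entry_instants ?x U \<inter> {..t})" for t
    using elim by (intro finite_entry_instants_atMost) blast
  have DU: "segment_count ?x D U t \<le> Suc (segment_count ?x U D t)" for t
    using segment_count_le[OF \<open>D \<inter> U = {}\<close>] finD finU .
  have UD: "segment_count ?x U D t \<le> Suc (segment_count ?x D U t)" for t
    using segment_count_le[of U D] finU finD \<open>D \<inter> U = {}\<close> by (simp add: Int_commute)
  show ?case
    using rate_limit_le[OF DU] rate_limit_le[OF UD] by (meson order.antisym)
qed

end
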